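(* Let $(X,d_X)=(\{x_0,x_1,\dots,x_n\},d_X)$ be a nondegenerate finite ultrametric space with $|X|=n+1\geq 3$ (the points $x_0,\dots,x_n$ being distinct), let $\alpha_1>0$ be the minimum nonzero distance in $X$, and let $p>0$. Let $B_1,\dots,B_r$ be the distinct coteries of $X$, let $X_0=X\setminus\bigcup_{i=1}^r B_i$, and for $Y\subseteq X$ let $\mathcal{I}(Y)=\{0\leq i\leq n: x_i\in Y\}$. Let $$\Pi_0=\{\xi=(\xi_0,\xi_1,\dots,\xi_n)^T\in\mathbb{R}^{n+1}:\xi_0+\xi_1+\dots+\xi_n=0\},$$ $$F=\Big\{\xi\in\Pi_0:\ \xi_i=0\ \text{ for all } i\in\mathcal{I}(X_0)\cup\{0\}\ \text{ and }\ \sum_{i\in\mathcal{I}(B_j)}\xi_i=0\ \text{ for all } 1\leq j\leq r\Big\},$$ and define $\pi:\Pi_0\rightarrow\mathbb{R}^n$ by $\pi(\xi_0,\xi_1,\dots,\xi_n)=(\xi_1,\dots,\xi_n)$. Let $E\subseteq\mathbb{R}^n$ be the eigenspace of the $p$-Gramian $G_p=G_p(X)$ corresponding to its minimum eigenvalue $\lambda_{\min}(G_p)=\alpha_1^p/2$. Then $E=\pi(F)$.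
   Context: A metric space $(X,d_X)$ is an ultrametric space if $d_X(x,y)\leq\max\{d_X(x,z),d_X(y,z)\}$ for all $x,y,z\in X$. The $p$-Gramian of $(X,d_X)=(\{x_0,x_1,\dots,x_n\},d_X)$ is the real symmetric $n\times n$ matrix $G_p(X)=(g_{ij})_{i,j=1}^n$ with $g_{ij}=\frac12\left(d_X(x_i,x_0)^p+d_X(x_j,x_0)^p-d_X(x_i,x_j)^p\right)$. It depends on the choice of the base point $x_0$ and on the labelling of the points. Its minimum eigenvalue is denoted $\lambda_{\min}(G_p)$. Let $X$ be a finite ultrametric space with minimum nonzero distance $\alpha_1$. For $z\in X$, the set $B_z(\alpha_1)=\{x\in X: d_X(x,z)\leq\alpha_1\}$ is called a coterie in $X$ if $|B_z(\alpha_1)|>1$. Any two coteries are either equal or disjoint. The (labelled) finite ultrametric space $X=\{x_0,\dots,x_n\}$ is called degenerate if there is exactly one coterie $B\subseteq X$ and $|B|=2$ and $x_0\in B$. Otherwise it is called nondegenerate. For nondegenerate $X$ with $|X|\geq 3$ and $p>0$, the minimum eigenvalue of $G_p$ equals $\alpha_1^p/2$. *)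

theory Defs
  imports "HOL-Analysis.Abstract_Metric_Spaces" "Jordan_Normal_Form.Char_Poly"
begin

no_notation Finite_Cartesian_Product.vec_nth (infixl "$" 90)

definition ultrametric_space :: "'a set \<Rightarrow> ('a \<Rightarrow> 'a \<Rightarrow> real) \<Rightarrow> bool" where
  "ultrametric_space X d \<longleftrightarrow>
     Metric_space X d \<and> (\<forall>x\<in>X. \<forall>y\<in>X. \<forall>z\<in>X. d x y \<le> max (d x z) (d y z))"

text \<open>The next definition is meaningful for finite \<open>X\<close> with at least two points; otherwise
  \<open>Min\<close> may be taken of an empty or an infinite set.\<close>

definition min_nonzero_dist :: "'a set \<Rightarrow> ('a \<Rightarrow> 'a \<Rightarrow> real) \<Rightarrow> real" where
  "min_nonzero_dist X d = Min {d x y | x y. x \<in> X \<and> y \<in> X \<and> d x y \<noteq> 0}"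

definition coteries :: "'a set \<Rightarrow> ('a \<Rightarrow> 'a \<Rightarrow> real) \<Rightarrow> 'a set set" where
  "coteries X d = {B. \<exists>z\<in>X. B = Metric_space.mcball X d z (min_nonzero_dist X d) \<and> card B > 1}"

definition degenerate :: "'a set \<Rightarrow> ('a \<Rightarrow> 'a \<Rightarrow> real) \<Rightarrow> 'a \<Rightarrow> bool" where
  "degenerate X d b \<longleftrightarrow> (\<exists>B. coteries X d = {B} \<and> card B = 2 \<and> b \<in> B)"

text \<open>Points are labelled by \<open>x 0, \<dots>, x n\<close>, with base point \<open>x 0\<close>. Matrices and vectors are
  indexed from 0, so row \<open>i\<close> of the Gramian belongs to the point \<open>x (Suc i)\<close>.\<close>

definition gramian :: "real \<Rightarrow> ('a \<Rightarrow> 'a \<Rightarrow> real) \<Rightarrow> (nat \<Rightarrow> 'a) \<Rightarrow> nat \<Rightarrow> real mat" where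
  "gramian p d x n = mat n n (\<lambda>(i, j).
     (d (x (Suc i)) (x 0) powr p + d (x (Suc j)) (x 0) powr p
        - d (x (Suc i)) (x (Suc j)) powr p) / 2)"

text \<open>Only the real eigenvalues are considered, which are all of them for a symmetric matrix.\<close>

definition min_eigenvalue :: "real mat \<Rightarrow> real" where
  "min_eigenvalue A = Min {k. eigenvalue A k}"

definition eigenspace :: "real mat \<Rightarrow> real \<Rightarrow> real vec set" where
  "eigenspace A k = {v \<in> carrier_vec (dim_row A). A *\<^sub>v v = k \<cdot>\<^sub>v v}"

definition indices :: "(nat \<Rightarrow> 'a) \<Rightarrow> nat \<Rightarrow> 'a set \<Rightarrow> nat set" where
  "indices x n Y = {i. i \<le> n \<and> x i \<in> Y}"

definition Pi0 :: "nat \<Rightarrow> real vec set" where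
  "Pi0 n = {\<xi> \<in> carrier_vec (n + 1). (\<Sum>i\<le>n. \<xi> $ i) = 0}"

definition outside_coteries :: "'a set \<Rightarrow> ('a \<Rightarrow> 'a \<Rightarrow> real) \<Rightarrow> 'a set" where
  "outside_coteries X d = X - \<Union> (coteries X d)"

definition F_space :: "'a set \<Rightarrow> ('a \<Rightarrow> 'a \<Rightarrow> real) \<Rightarrow> (nat \<Rightarrow> 'a) \<Rightarrow> nat \<Rightarrow> real vec set" where
  "F_space X d x n = {\<xi> \<in> Pi0 n.
     (\<forall>i \<in> indices x n (outside_coteries X d) \<union> {0}. \<xi> $ i = 0) \<and>
     (\<forall>B \<in> coteries X d. (\<Sum>i \<in> indices x n B. \<xi> $ i) = 0)}"

definition drop_base :: "nat \<Rightarrow> real vec \<Rightarrow> real vec" where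
  "drop_base n \<xi> = vec n (\<lambda>i. \<xi> $ Suc i)"

end

theory Submission
  imports Defs
begin

text \<open>
  Put \<open>D i j = d (x i) (x j) powr p\<close>, write \<open>\<alpha>\<close> for the minimum nonzero distance, and extend
  \<open>v\<close> in \<open>\<real>\<^sup>n\<close> to the vector \<open>\<xi> = (- (v\<^sub>1 + \<dots> + v\<^sub>n), v\<^sub>1, \<dots>, v\<^sub>n)\<close> of coordinate sum
  zero. The Gramian \<open>G\<close> satisfies \<open>2 (G v)\<^sub>i = (D \<xi>)\<^sub>0 - (D \<xi>)\<^sub>i\<close>
  (\<open>gramian_mult_drop_base\<close>), so \<open>2 (v \<bullet> G v) = - (\<xi> \<bullet> D \<xi>)\<close>. Off the diagonal every entry of \<open>D\<close> is
  at least \<open>\<alpha> powr p\<close>; subtracting this number there leaves a kernel \<open>D'\<close> that still satisfies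
  the ultrametric inequality, but that vanishes at all pairs of points at distance \<open>\<alpha>\<close>. On
  vectors of sum zero this reads
  \<open>- (\<xi> \<bullet> D \<xi>) = \<alpha> powr p * (\<xi> \<bullet> \<xi>) - (\<xi> \<bullet> D' \<xi>)\<close>.

  The main tool is \<open>ultrametric_kernel_negative_type\<close>: for an ultrametric kernel the quadratic
  form is nonpositive on vectors of sum zero, and where it vanishes the coordinates of \<open>\<xi>\<close> sum
  to zero over each class of indices at mutual distance zero. For \<open>D'\<close> these classes are
  exactly the coteries and the single points outside all coteries. Therefore
  \<open>v \<bullet> G v \<ge> (\<alpha> powr p / 2) (\<xi> \<bullet> \<xi>) \<ge> (\<alpha> powr p / 2) (v \<bullet> v)\<close>, and equality forces \<open>\<xi>\<^sub>0 = 0\<close>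
  and the vanishing of all class sums, which says that \<open>\<xi>\<close> lies in \<open>F\<close>. Conversely, if \<open>\<xi>\<close>
  is in \<open>F\<close>, then \<open>D' \<xi> = 0\<close> because each row of \<open>D'\<close> is constant on the classes, and the
  formula for \<open>G v\<close> makes \<open>v\<close> an eigenvector. Nondegeneracy supplies two points of one
  coterie that differ from the base point; the difference of their unit vectors is a nonzero
  element of \<open>F\<close>, so \<open>\<alpha> powr p / 2\<close> really is an eigenvalue.
\<close>

section \<open>Ultrametric kernels and their quadratic forms\<close>

text \<open>Distinct indices may have distance zero: this happens for the kernels obtained from an
  ultrametric by subtracting a constant and truncating at zero.\<close>

definition ultrametric_kernel :: "'i set \<Rightarrow> ('i \<Rightarrow> 'i \<Rightarrow> real) \<Rightarrow> bool" where
  "ultrametric_kernel I D \<longleftrightarrow>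
     (\<forall>i\<in>I. D i i = 0) \<and> (\<forall>i\<in>I. \<forall>j\<in>I. D i j = D j i) \<and>
     (\<forall>i\<in>I. \<forall>j\<in>I. \<forall>k\<in>I. D i k \<le> max (D i j) (D j k))"

definition quad_form :: "'i set \<Rightarrow> ('i \<Rightarrow> 'i \<Rightarrow> real) \<Rightarrow> ('i \<Rightarrow> real) \<Rightarrow> real" where
  "quad_form I D \<xi> = (\<Sum>i\<in>I. \<Sum>j\<in>I. D i j * \<xi> j * \<xi> i)"

definition null_class :: "'i set \<Rightarrow> ('i \<Rightarrow> 'i \<Rightarrow> real) \<Rightarrow> 'i \<Rightarrow> 'i set" where
  "null_class I D i = {j \<in> I. D i j = 0}"

lemma ultrametric_kernelD:
  assumes "ultrametric_kernel I D"
  shows "i \<in> I \<Longrightarrow> D i i = 0"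
    and "i \<in> I \<Longrightarrow> j \<in> I \<Longrightarrow> D i j = D j i"
    and "i \<in> I \<Longrightarrow> j \<in> I \<Longrightarrow> k \<in> I \<Longrightarrow> D i k \<le> max (D i j) (D j k)"
  using assms unfolding ultrametric_kernel_def by blast+

lemma ultrametric_kernel_nonneg:
  assumes "ultrametric_kernel I D" "i \<in> I" "j \<in> I"
  shows "0 \<le> D i j"
  using ultrametric_kernelD[OF assms(1)] assms(2,3) by (metis max.idem)

text \<open>A monotone function commutes with the maximum, so it respects the ultrametric inequality.
  This covers both taking powers and truncating.\<close>

lemma ultrametric_kernel_mono_image:
  assumes D: "ultrametric_kernel I D" and f: "mono_on {0..} f" "f 0 = 0"
  shows "ultrametric_kernel I (\<lambda>i j. f (D i j))"
proof -
  have "f (D i k) \<le> max (f (D i j)) (f (D j k))" if "i \<in> I" "j \<in> I" "k \<in> I" for i j k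
  proof -
    have "f (D i k) \<le> f (max (D i j) (D j k))"
      using that ultrametric_kernelD(3)[OF D] ultrametric_kernel_nonneg[OF D]
      by (intro mono_onD[OF f(1)]) (auto simp: le_max_iff_disj)
    then show ?thesis by (auto simp: max_def split: if_splits)
  qed
  then show ?thesis
    using f(2) ultrametric_kernelD(1,2)[OF D] unfolding ultrametric_kernel_def by simp
qed

lemma ultrametric_kernel_truncate:
  assumes "ultrametric_kernel I D" "0 \<le> m"
  shows "ultrametric_kernel I (\<lambda>i j. max 0 (D i j - m))"
  using assms(2) by (intro ultrametric_kernel_mono_image[OF assms(1)] mono_onI) auto

text \<open>The ultrametric inequality used in both directions shows that the kernel descends to the
  classes of indices at mutual distance zero; in particular these classes are well defined.\<close>

lemma kernel_eq_of_zero: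
  assumes D: "ultrametric_kernel I D" and ijk: "i \<in> I" "j \<in> I" "k \<in> I" and z: "D j k = 0"
  shows "D i j = D i k"
  using ultrametric_kernelD(3)[OF D ijk(1,2,3)] ultrametric_kernelD(3)[OF D ijk(1,3,2)]
    ultrametric_kernelD(2)[OF D ijk(2,3)] ultrametric_kernel_nonneg[OF D] ijk z
  by (metis antisym max.absorb1)

lemma null_class_eq:
  assumes "ultrametric_kernel I D" "i \<in> I" "j \<in> I" "D i j = 0"
  shows "null_class I D i = null_class I D j"
  using kernel_eq_of_zero[OF assms(1) _ assms(2,3,4)] ultrametric_kernelD(2)[OF assms(1)] assms(2,3)
  unfolding null_class_def by (metis (no_types, lifting))

text \<open>Replacing \<open>\<xi>\<close> by its average over each class does not change its pairing with a function
  that is constant on classes. Averaging in this way decomposes sums along the classes while still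
  summing over indices, which avoids passing to the quotient.\<close>

lemma sum_eq_sum_class_sums:
  fixes h \<xi> :: "'i \<Rightarrow> real"
  assumes fin: "finite I" and D: "ultrametric_kernel I D"
    and h: "\<And>i j. i \<in> I \<Longrightarrow> j \<in> I \<Longrightarrow> D i j = 0 \<Longrightarrow> h i = h j"
  shows "(\<Sum>i\<in>I. h i * \<xi> i) =
    (\<Sum>i\<in>I. h i * sum \<xi> (null_class I D i) / card (null_class I D i))"
proof -
  let ?c = "\<lambda>i. real (card (null_class I D i))"
  have "(\<Sum>i\<in>I. h i * sum \<xi> (null_class I D i) / ?c i) =
      (\<Sum>i\<in>I. \<Sum>j\<in>{j\<in>I. D i j = 0}. h i / ?c i * \<xi> j)"
    by (simp add: null_class_def sum_distrib_left sum_divide_distrib)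
  also have "\<dots> = (\<Sum>j\<in>I. \<Sum>i\<in>{i\<in>I. D i j = 0}. h i / ?c i * \<xi> j)"
    by (rule sum.swap_restrict[OF fin fin])
  also have "\<dots> = (\<Sum>j\<in>I. h j * \<xi> j)"
  proof (rule sum.cong[OF refl])
    fix j assume j: "j \<in> I"
    have cls: "{i\<in>I. D i j = 0} = null_class I D j"
      using ultrametric_kernelD(2)[OF D] j unfolding null_class_def by auto
    have "j \<in> null_class I D j" "finite (null_class I D j)"
      using j fin ultrametric_kernelD(1)[OF D] by (auto simp: null_class_def)
    then have "?c j > 0" by (auto simp: card_gt_0_iff)
    have "(\<Sum>i\<in>{i\<in>I. D i j = 0}. h i / ?c i * \<xi> j)
        = (\<Sum>i\<in>null_class I D j. h j / ?c j * \<xi> j)"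
    proof (rule sum.cong[OF cls])
      fix i assume "i \<in> null_class I D j"
      then have "i \<in> I" "D i j = 0" using cls by auto
      then show "h i / ?c i * \<xi> j = h j / ?c j * \<xi> j"
        using h[OF _ j] null_class_eq[OF D _ j] by simp
    qed
    also have "\<dots> = h j * \<xi> j" using \<open>?c j > 0\<close> by simp
    finally show "(\<Sum>i\<in>{i\<in>I. D i j = 0}. h i / ?c i * \<xi> j) = h j * \<xi> j" .
  qed
  finally show ?thesis by simp
qed

text \<open>The form whose matrix is the indicator of \<open>D i j = 0\<close> is block diagonal with all-ones blocks,
  hence it is the sum of the squares of the class sums. Averaging, applied to the class sum
  itself, exhibits these squares: each index contributes the square of its class sum divided by
  the size of the class.\<close>

lemma class_form_nonneg:
  fixes \<xi> :: "'i \<Rightarrow> real"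
  assumes fin: "finite I" and D: "ultrametric_kernel I D"
  shows "0 \<le> (\<Sum>i\<in>I. sum \<xi> (null_class I D i) * \<xi> i)"
    and "(\<Sum>i\<in>I. sum \<xi> (null_class I D i) * \<xi> i) = 0 \<Longrightarrow> i \<in> I \<Longrightarrow> sum \<xi> (null_class I D i) = 0"
proof -
  let ?s = "\<lambda>i. sum \<xi> (null_class I D i)"
  let ?c = "\<lambda>i. real (card (null_class I D i))"
  have eq: "(\<Sum>i\<in>I. ?s i * \<xi> i) = (\<Sum>i\<in>I. ?s i * ?s i / ?c i)"
    by (rule sum_eq_sum_class_sums[OF fin D]) (simp add: null_class_eq[OF D])
  show "0 \<le> (\<Sum>i\<in>I. ?s i * \<xi> i)"
    unfolding eq by (intro sum_nonneg) simp
  assume z: "(\<Sum>i\<in>I. ?s i * \<xi> i) = 0" and i: "i \<in> I"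
  have "i \<in> null_class I D i" "finite (null_class I D i)"
    using i fin ultrametric_kernelD(1)[OF D] by (auto simp: null_class_def)
  then have "?c i > 0" by (auto simp: card_gt_0_iff)
  have "?s i * ?s i / ?c i = 0"
    using z i unfolding eq by (subst (asm) sum_nonneg_eq_0_iff[OF fin]) auto
  with \<open>?c i > 0\<close> show "?s i = 0" by simp
qed

text \<open>Subtracting \<open>m\<close> from all nonzero entries of \<open>D\<close> subtracts \<open>m\<close> times the all-ones kernel
  minus the indicator of \<open>D i j = 0\<close>, and the all-ones kernel annihilates vectors of sum zero.\<close>

lemma kernel_apply_split:
  assumes fin: "finite I" and D: "ultrametric_kernel I D" and i: "i \<in> I"
    and m: "0 \<le> m" "\<And>j. j \<in> I \<Longrightarrow> D i j \<noteq> 0 \<Longrightarrow> m \<le> D i j"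
    and \<xi>: "sum \<xi> I = 0"
  shows "(\<Sum>j\<in>I. D i j * \<xi> j) =
    (\<Sum>j\<in>I. max 0 (D i j - m) * \<xi> j) - m * sum \<xi> (null_class I D i)"
proof -
  have "D i j * \<xi> j = max 0 (D i j - m) * \<xi> j + m * \<xi> j - (if D i j = 0 then m * \<xi> j else 0)"
    if "j \<in> I" for j
    using m(1) m(2)[OF that] by (auto simp: algebra_simps)
  then have "(\<Sum>j\<in>I. D i j * \<xi> j) = (\<Sum>j\<in>I. max 0 (D i j - m) * \<xi> j) + m * sum \<xi> I
      - (\<Sum>j\<in>I. if D i j = 0 then m * \<xi> j else 0)"
    by (simp add: sum.distrib sum_subtractf sum_distrib_left)
  also have "(\<Sum>j\<in>I. if D i j = 0 then m * \<xi> j else 0) = m * sum \<xi> (null_class I D i)"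
    unfolding null_class_def sum.inter_filter[OF fin] sum_distrib_left
    by (intro sum.cong) auto
  finally show ?thesis using \<xi> by simp
qed

lemma quad_form_split:
  assumes fin: "finite I" and D: "ultrametric_kernel I D"
    and m: "0 \<le> m" "\<And>i j. i \<in> I \<Longrightarrow> j \<in> I \<Longrightarrow> D i j \<noteq> 0 \<Longrightarrow> m \<le> D i j"
    and \<xi>: "sum \<xi> I = 0"
  shows "quad_form I D \<xi> = quad_form I (\<lambda>i j. max 0 (D i j - m)) \<xi>
    - m * (\<Sum>i\<in>I. sum \<xi> (null_class I D i) * \<xi> i)"
proof -
  have "quad_form I D \<xi> = (\<Sum>i\<in>I. (\<Sum>j\<in>I. D i j * \<xi> j) * \<xi> i)"
    by (simp add: quad_form_def sum_distrib_right)
  also have "\<dots> = (\<Sum>i\<in>I. ((\<Sum>j\<in>I. max 0 (D i j - m) * \<xi> j)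
      - m * sum \<xi> (null_class I D i)) * \<xi> i)"
    using kernel_apply_split[OF fin D _ m(1) _ \<xi>] m(2) by (intro sum.cong) auto
  also have "\<dots> = (\<Sum>i\<in>I. (\<Sum>j\<in>I. max 0 (D i j - m) * \<xi> j) * \<xi> i)
      - m * (\<Sum>i\<in>I. sum \<xi> (null_class I D i) * \<xi> i)"
    by (simp add: left_diff_distrib sum_subtractf mult.assoc flip: sum_distrib_left)
  finally show ?thesis by (simp add: quad_form_def sum_distrib_right)
qed

text \<open>An ultrametric kernel is a nonnegative combination, over its levels, of indicators of the
  complements of equivalence relations, and each of these is nonpositive on vectors of sum
  zero. The induction peels off one level at a time, namely the smallest nonzero value \<open>m\<close>;
  truncation at \<open>m\<close> keeps the kernel ultrametric and lowers the number of nonzero values.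
  If the whole form vanishes, so does the contribution of the lowest level, which is \<open>m\<close> times
  the sum of squares of the class sums.\<close>

lemma ultrametric_kernel_negative_type:
  assumes fin: "finite I" and \<xi>: "sum \<xi> I = 0" and D: "ultrametric_kernel I D"
  shows "quad_form I D \<xi> \<le> 0 \<and>
    (quad_form I D \<xi> = 0 \<longrightarrow> (\<forall>i\<in>I. sum \<xi> (null_class I D i) = 0))"
  using D
proof (induction "card ((\<lambda>(i, j). D i j) ` (I \<times> I) - {0})" arbitrary: D rule: less_induct)
  case less
  note D = \<open>ultrametric_kernel I D\<close>
  define V where "V = (\<lambda>(i, j). D i j) ` (I \<times> I) - {0}"
  have finV: "finite V" using fin by (simp add: V_def)
  show ?case
  proof (cases "V = {}")
    case True
    then have z: "D i j = 0" if "i \<in> I" "j \<in> I" for i j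
      using that unfolding V_def by (auto simp: image_subset_iff)
    then have "quad_form I D \<xi> = 0" by (simp add: quad_form_def)
    moreover have "null_class I D i = I" if "i \<in> I" for i
      using z that by (auto simp: null_class_def)
    ultimately show ?thesis using \<xi> by simp
  next
    case False
    define m where "m = Min V"
    have mV: "m \<in> V" using finV False by (simp add: m_def)
    then have m0: "0 < m"
      using ultrametric_kernel_nonneg[OF D] by (force simp: V_def)
    have mle: "m \<le> D i j" if "i \<in> I" "j \<in> I" "D i j \<noteq> 0" for i j
      unfolding m_def using finV that by (intro Min_le) (auto simp: V_def)
    let ?D = "\<lambda>i j. max 0 (D i j - m)"
    have "(\<lambda>(i, j). ?D i j) ` (I \<times> I) - {0} \<subseteq> (\<lambda>t. max 0 (t - m)) ` (V - {m})"
      using m0 by (force simp: V_def)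
    then have "card ((\<lambda>(i, j). ?D i j) ` (I \<times> I) - {0}) \<le> card (V - {m})"
      using finV by (meson card_image_le card_mono finite_Diff finite_imageI le_trans)
    also have "\<dots> < card V" using finV mV by (rule card_Diff1_less)
    finally have neg: "quad_form I ?D \<xi> \<le> 0"
      using less.hyps ultrametric_kernel_truncate[OF D] m0 unfolding V_def by simp
    let ?q = "\<Sum>i\<in>I. sum \<xi> (null_class I D i) * \<xi> i"
    have split: "quad_form I D \<xi> = quad_form I ?D \<xi> - m * ?q"
      using m0 mle by (intro quad_form_split[OF fin D _ _ \<xi>]) auto
    have q: "0 \<le> m * ?q"
      using class_form_nonneg(1)[OF fin D] m0 by simp
    show ?thesis
    proof (intro conjI impI ballI)
      show "quad_form I D \<xi> \<le> 0" using neg split q by linarith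
    next
      fix i assume "quad_form I D \<xi> = 0" and i: "i \<in> I"
      then have "m * ?q = 0" using neg split q by linarith
      then have "?q = 0" using m0 by simp
      then show "sum \<xi> (null_class I D i) = 0"
        using i by (rule class_form_nonneg(2)[OF fin D])
    qed
  qed
qed

section \<open>The Gramian acting on vectors of coefficient sum zero\<close>

text \<open>The inverse of \<open>drop_base\<close> on vectors of sum zero.\<close>

definition add_base :: "nat \<Rightarrow> real vec \<Rightarrow> real vec" where
  "add_base n v = vec (n + 1) (\<lambda>i. if i = 0 then - (\<Sum>j<n. v $ j) else v $ (i - 1))"

lemma add_base_Pi0: "add_base n v \<in> Pi0 n"
  by (simp add: add_base_def Pi0_def sum.atMost_shift)

lemma drop_add_base: "v \<in> carrier_vec n \<Longrightarrow> drop_base n (add_base n v) = v"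
  by (auto simp: add_base_def drop_base_def)

text \<open>The two terms of the Gramian that involve the base point combine with the coordinate
  \<open>\<xi>\<^sub>0 = - (\<xi>\<^sub>1 + \<dots> + \<xi>\<^sub>n)\<close> so that the sums extend over all points, the base point included.\<close>

lemma gramian_mult_drop_base:
  assumes \<xi>: "\<xi> \<in> Pi0 n" and i: "i < n" and D0: "d (x 0) (x 0) = 0"
    and sym: "\<And>i. i \<le> n \<Longrightarrow> d (x i) (x 0) = d (x 0) (x i)"
  shows "(gramian p d x n *\<^sub>v drop_base n \<xi>) $ i =
    ((\<Sum>j\<le>n. d (x 0) (x j) powr p * \<xi> $ j) - (\<Sum>j\<le>n. d (x (Suc i)) (x j) powr p * \<xi> $ j)) / 2"
proof -
  let ?D = "\<lambda>i j. d (x i) (x j) powr p"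
  have \<xi>0: "(\<Sum>j<n. \<xi> $ Suc j) = - \<xi> $ 0"
    using \<xi> by (simp add: Pi0_def sum.atMost_shift)
  have "(gramian p d x n *\<^sub>v drop_base n \<xi>) $ i =
      (\<Sum>j<n. (?D (Suc i) 0 + ?D (Suc j) 0 - ?D (Suc i) (Suc j)) / 2 * \<xi> $ Suc j)"
    using i by (simp add: gramian_def drop_base_def scalar_prod_def atLeast0LessThan)
  also have "\<dots> = (\<Sum>j<n. ?D (Suc i) 0 * \<xi> $ Suc j + ?D 0 (Suc j) * \<xi> $ Suc j
      - ?D (Suc i) (Suc j) * \<xi> $ Suc j) / 2"
    unfolding sum_divide_distrib using sym by (intro sum.cong) (auto simp: field_simps)
  also have "\<dots> = (?D (Suc i) 0 * (\<Sum>j<n. \<xi> $ Suc j) + (\<Sum>j<n. ?D 0 (Suc j) * \<xi> $ Suc j)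
      - (\<Sum>j<n. ?D (Suc i) (Suc j) * \<xi> $ Suc j)) / 2"
    by (simp add: sum.distrib sum_subtractf sum_distrib_left)
  finally show ?thesis
    using D0 by (simp add: \<xi>0 sum.atMost_shift)
qed

section \<open>Labelled finite ultrametric spaces\<close>

locale labelled_ultrametric =
  fixes X :: "'a set" and d :: "'a \<Rightarrow> 'a \<Rightarrow> real" and x :: "nat \<Rightarrow> 'a" and n :: nat
  assumes ultra: "ultrametric_space X d" and bij: "bij_betw x {0..n} X" and n_pos: "0 < n"
begin

abbreviation "\<alpha> \<equiv> min_nonzero_dist X d"

sublocale M: Metric_space X d
  using ultra by (simp add: ultrametric_space_def)

lemma X_eq: "X = x ` {..n}"
  using bij by (simp add: bij_betw_def atLeast0AtMost)

lemma label_in [simp]: "i \<le> n \<Longrightarrow> x i \<in> X"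
  by (simp add: X_eq)

lemma labelE:
  assumes "y \<in> X"
  obtains i where "i \<le> n" "y = x i"
  using assms unfolding X_eq by auto

lemma label_inj: "i \<le> n \<Longrightarrow> j \<le> n \<Longrightarrow> x i = x j \<longleftrightarrow> i = j"
  using bij by (auto simp: bij_betw_def inj_on_def)

lemma finite_X: "finite X" by (simp add: X_eq)

lemma ultra_le: "y \<in> X \<Longrightarrow> z \<in> X \<Longrightarrow> w \<in> X \<Longrightarrow> d y z \<le> max (d y w) (d w z)"
  using ultra M.commute by (metis ultrametric_space_def)

lemma finite_distances: "finite {d y z |y z. y \<in> X \<and> z \<in> X \<and> d y z \<noteq> 0}"
proof -
  have "{d y z |y z. y \<in> X \<and> z \<in> X \<and> d y z \<noteq> 0} \<subseteq> (\<lambda>(y, z). d y z) ` (X \<times> X)" by auto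
  then show ?thesis using finite_X by (meson finite_SigmaI finite_imageI finite_subset)
qed

lemma min_dist_le: "y \<in> X \<Longrightarrow> z \<in> X \<Longrightarrow> y \<noteq> z \<Longrightarrow> \<alpha> \<le> d y z"
  unfolding min_nonzero_dist_def 
  by (intro Min_le[OF finite_distances] CollectI exI[of _ y] exI[of _ z]) auto

lemma min_dist_attained: "\<exists>y\<in>X. \<exists>z\<in>X. y \<noteq> z \<and> d y z = \<alpha>"
proof -
  have "x 0 \<noteq> x 1" using label_inj[of 0 1] n_pos by auto
  then have "d (x 0) (x 1) \<in> {d y z |y z. y \<in> X \<and> z \<in> X \<and> d y z \<noteq> 0}"
    using n_pos by (intro CollectI exI[of _ "x 0"] exI[of _ "x 1"]) auto
  then have "\<alpha> \<in> {d y z |y z. y \<in> X \<and> z \<in> X \<and> d y z \<noteq> 0}"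
    unfolding min_nonzero_dist_def using Min_in[OF finite_distances] by blast
  then show ?thesis by force
qed

lemma min_dist_pos: "0 < \<alpha>"
  using min_dist_attained M.mdist_pos_less by metis

lemma mcball_eq:
  assumes "y \<in> M.mcball z \<alpha>"
  shows "M.mcball y \<alpha> = M.mcball z \<alpha>"
proof -
  have *: "M.mcball y \<alpha> \<subseteq> M.mcball z \<alpha>" if "y \<in> M.mcball z \<alpha>" for y z
    using that ultra_le by (fastforce simp: M.mcball_def)
  have "z \<in> M.mcball y \<alpha>" using assms M.commute by (auto simp: M.mcball_def)
  then show ?thesis using *[OF assms] * by blast
qed

lemma centre_in_mcball: "z \<in> X \<Longrightarrow> z \<in> M.mcball z \<alpha>"
  using min_dist_pos by (simp add: M.mcball_def)

lemma finite_mcball: "finite (M.mcball z \<alpha>)"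
  using finite_X by (simp add: M.mcball_def)

lemma coterie_eq_mcball:
  assumes "B \<in> coteries X d" "y \<in> B"
  shows "B = M.mcball y \<alpha>"
proof -
  obtain z where "B = M.mcball z \<alpha>" using assms(1) by (auto simp: coteries_def)
  then show ?thesis using mcball_eq[of y z] assms(2) by blast
qed

lemma mcball_in_coteries_iff:
  assumes "y \<in> X"
  shows "M.mcball y \<alpha> \<in> coteries X d \<longleftrightarrow> y \<notin> outside_coteries X d"
proof
  assume "M.mcball y \<alpha> \<in> coteries X d"
  then show "y \<notin> outside_coteries X d"
    using centre_in_mcball[OF assms] unfolding outside_coteries_def by blast
next
  assume "y \<notin> outside_coteries X d"
  then obtain B where B: "B \<in> coteries X d" "y \<in> B"
    using assms unfolding outside_coteries_def by blast
  have "B = M.mcball y \<alpha>" using B by (rule coterie_eq_mcball)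
  with B(1) show "M.mcball y \<alpha> \<in> coteries X d" by simp
qed

lemma mcball_outside:
  assumes "y \<in> outside_coteries X d"
  shows "M.mcball y \<alpha> = {y}"
proof -
  have y: "y \<in> X" using assms by (simp add: outside_coteries_def)
  then have "\<not> card (M.mcball y \<alpha>) > 1"
    using mcball_in_coteries_iff[OF y] assms by (auto simp: coteries_def)
  moreover have "M.mcball y \<alpha> \<noteq> {}" using centre_in_mcball[OF y] by blast
  then have "0 < card (M.mcball y \<alpha>)" unfolding card_gt_0_iff using finite_mcball by blast
  ultimately have "card (M.mcball y \<alpha>) = 1" by linarith
  then obtain w where w: "M.mcball y \<alpha> = {w}" by (rule card_1_singletonE)
  have "y = w" using centre_in_mcball[OF y] unfolding w by (rule singletonD)
  then show ?thesis using w by simp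
qed

text \<open>The ball around a point outside all coteries is that point alone, so the condition that
  \<open>\<xi>\<close> vanishes there is the class sum condition for a singleton. This puts the two kinds of
  conditions that define \<open>F\<close> into one form.\<close>

lemma F_space_iff:
  "\<xi> \<in> F_space X d x n \<longleftrightarrow> \<xi> \<in> Pi0 n \<and> \<xi> $ 0 = 0 \<and>
     (\<forall>i\<le>n. sum (($) \<xi>) (indices x n (M.mcball (x i) \<alpha>)) = 0)"
proof -
  have single: "indices x n (M.mcball (x i) \<alpha>) = {i}"
    if "i \<le> n" "x i \<in> outside_coteries X d" for i
    unfolding mcball_outside[OF that(2)] indices_def using label_inj[OF _ that(1)] that(1) by auto
  have ball: "\<exists>i\<le>n. B = M.mcball (x i) \<alpha>" if B: "B \<in> coteries X d" for B
  proof -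
    obtain z where z: "z \<in> X" "B = M.mcball z \<alpha>" using B unfolding coteries_def by blast
    obtain i where "i \<le> n" "z = x i" using z(1) by (rule labelE)
    then show ?thesis using z(2) by (intro exI[of _ i]) simp
  qed
  show ?thesis (is "?l \<longleftrightarrow> ?r")
  proof
    assume l: ?l
    have "sum (($) \<xi>) (indices x n (M.mcball (x i) \<alpha>)) = 0" if i: "i \<le> n" for i
    proof (cases "x i \<in> outside_coteries X d")
      case True
      then have "\<xi> $ i = 0" using l i by (simp add: F_space_def indices_def)
      then show ?thesis unfolding single[OF i True] by simp
    next
      case False
      then have "M.mcball (x i) \<alpha> \<in> coteries X d" using mcball_in_coteries_iff i by simp
      then show ?thesis using l unfolding F_space_def by blast
    qed
    then show ?r using l by (simp add: F_space_def)
  next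
    assume r: ?r
    have "\<xi> $ i = 0" if "i \<in> indices x n (outside_coteries X d)" for i
    proof -
      have i: "i \<le> n" "x i \<in> outside_coteries X d" using that by (simp_all add: indices_def)
      then have "sum (($) \<xi>) {i} = 0" using r unfolding single[OF i, symmetric] by simp
      then show ?thesis by simp
    qed
    moreover have "sum (($) \<xi>) (indices x n B) = 0" if "B \<in> coteries X d" for B
      using ball[OF that] r by blast
    ultimately show ?l using r unfolding F_space_def by blast
  qed
qed

text \<open>A coterie that misses the base point contains two points to choose. If there is none, all
  coteries contain the base point and hence coincide; the only one then has at least three
  points, since a coterie of two points would make the space degenerate.\<close>

lemma two_nonbase_points_in_ball:
  assumes "\<not> degenerate X d (x 0)"
  shows "\<exists>i\<in>{1..n}. \<exists>j\<in>{1..n}. i \<noteq> j \<and> d (x i) (x j) \<le> \<alpha>"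
proof -
  obtain y z where yz: "y \<in> X" "z \<in> X" "y \<noteq> z" "d y z = \<alpha>"
    using min_dist_attained by blast
  then have "{y, z} \<subseteq> M.mcball y \<alpha>" using min_dist_pos by (auto simp: M.mcball_def)
  then have "card {y, z} \<le> card (M.mcball y \<alpha>)" by (rule card_mono[OF finite_mcball])
  then have yc: "M.mcball y \<alpha> \<in> coteries X d" using yz by (auto simp: coteries_def)
  have "\<exists>B\<in>coteries X d. card (B - {x 0}) \<ge> 2"
  proof (cases "\<exists>B\<in>coteries X d. x 0 \<notin> B")
    case True
    then obtain B where B: "B \<in> coteries X d" "x 0 \<notin> B" by blast
    then have "1 < card B" "B - {x 0} = B" unfolding coteries_def by blast+
    then have "2 \<le> card (B - {x 0})" by simp
    with B(1) show ?thesis ..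
  next
    case False
    then have base: "B = M.mcball (x 0) \<alpha>" if "B \<in> coteries X d" for B
      using that by (intro coterie_eq_mcball) auto
    have "B = M.mcball y \<alpha>" if "B \<in> coteries X d" for B
      using base[OF that] base[OF yc] by (rule trans[OF _ sym])
    then have "coteries X d = {M.mcball y \<alpha>}" using yc by blast
    then have "card (M.mcball y \<alpha>) \<noteq> 2"
      using assms False unfolding degenerate_def by blast
    moreover have "card (M.mcball y \<alpha>) > 1" using yc unfolding coteries_def by blast
    moreover have "x 0 \<in> M.mcball y \<alpha>" using yc False by blast
    ultimately have "card (M.mcball y \<alpha> - {x 0}) \<ge> 2" by (simp add: card_Diff_singleton)
    with yc show ?thesis ..
  qed
  then obtain B where B: "B \<in> coteries X d" "card (B - {x 0}) \<ge> 2" by blast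
  then have "\<exists>S\<subseteq>B - {x 0}. card S = 2" by (meson obtain_subset_with_card_n)
  then obtain a b where ab: "a \<in> B" "b \<in> B" "a \<noteq> x 0" "b \<noteq> x 0" "a \<noteq> b"
    by (auto simp: card_2_iff)
  have "b \<in> M.mcball a \<alpha>" using coterie_eq_mcball[OF B(1)] ab by blast
  then have X: "a \<in> X" "b \<in> X" and le: "d a b \<le> \<alpha>" by (auto simp: M.mcball_def)
  obtain i where i: "i \<le> n" "a = x i" using X(1) by (rule labelE)
  obtain j where j: "j \<le> n" "b = x j" using X(2) by (rule labelE)
  have "i \<noteq> 0" "j \<noteq> 0" "i \<noteq> j" using ab i j by metis+
  then show ?thesis using i j le by (intro bexI[of _ i] bexI[of _ j]) auto
qed

lemma drop_base_F_space_nonzero: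
  assumes "\<not> degenerate X d (x 0)"
  shows "\<exists>v\<in>drop_base n ` F_space X d x n. v \<noteq> 0\<^sub>v n"
proof -
  obtain i j where ij: "i \<in> {1..n}" "j \<in> {1..n}" "i \<noteq> j" "d (x i) (x j) \<le> \<alpha>"
    using two_nonbase_points_in_ball[OF assms] by blast
  (* Every ball of radius \<alpha> contains both points or neither, so the difference of the two unit
     vectors has vanishing class sums. *)
  define \<xi> where "\<xi> = vec (n + 1) (\<lambda>k. (if k = i then 1 else 0) - (if k = j then 1 else (0::real)))"
  have \<xi>_sum: "sum (($) \<xi>) S = (if i \<in> S then 1 else 0) - (if j \<in> S then 1 else 0)"
    if "S \<subseteq> {..n}" for S
  proof -
    have "finite S" using that finite_subset by blast
    moreover have "sum (($) \<xi>) S = (\<Sum>k\<in>S. (if k = i then 1 else 0) - (if k = j then 1 else 0))"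
      using that by (intro sum.cong) (auto simp: \<xi>_def less_Suc_eq_le)
    ultimately show ?thesis by (simp add: sum_subtractf)
  qed
  have "\<xi> \<in> Pi0 n"
    using \<xi>_sum[of "{..n}"] ij by (simp add: Pi0_def) (simp add: \<xi>_def)
  moreover have "\<xi> $ 0 = 0" using ij by (simp add: \<xi>_def)
  moreover have "sum (($) \<xi>) (indices x n (M.mcball (x k) \<alpha>)) = 0" if k: "k \<le> n" for k
  proof -
    have "x j \<in> M.mcball (x i) \<alpha>" using ij by (simp add: M.mcball_def)
    then have "x i \<in> M.mcball (x k) \<alpha> \<longleftrightarrow> x j \<in> M.mcball (x k) \<alpha>"
      using mcball_eq ij centre_in_mcball[of "x i"] by (metis atLeastAtMost_iff label_in)
    then show ?thesis using ij by (subst \<xi>_sum) (auto simp: indices_def)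
  qed
  ultimately have "\<xi> \<in> F_space X d x n" by (simp add: F_space_iff)
  moreover have "drop_base n \<xi> $ (i - 1) = 1" using ij by (auto simp: drop_base_def \<xi>_def)
  then have "drop_base n \<xi> \<noteq> 0\<^sub>v n" using ij by auto
  ultimately show ?thesis by blast
qed

end

section \<open>The minimum eigenvalue and its eigenspace\<close>

locale labelled_ultrametric_power = labelled_ultrametric +
  fixes p :: real
  assumes p_pos: "0 < p"
begin

abbreviation "D \<equiv> \<lambda>i j. d (x i) (x j) powr p"

abbreviation "D' \<equiv> \<lambda>i j. max 0 (D i j - \<alpha> powr p)"

abbreviation "G \<equiv> gramian p d x n"

lemma kernel_D: "ultrametric_kernel {..n} D"
proof (rule ultrametric_kernel_mono_image[where f = "\<lambda>t. t powr p"])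
  show "ultrametric_kernel {..n} (\<lambda>i j. d (x i) (x j))"
    unfolding ultrametric_kernel_def
  proof (intro conjI ballI)
    fix i j assume "i \<in> {..n}" "j \<in> {..n}"
    show "d (x i) (x j) = d (x j) (x i)" by (rule M.commute)
  qed (simp_all add: ultra_le)
  show "mono_on {0..} (\<lambda>t. t powr p)" using p_pos by (intro mono_onI powr_mono2) auto
qed simp

lemma kernel_D': "ultrametric_kernel {..n} D'"
  by (rule ultrametric_kernel_truncate[OF kernel_D]) simp

lemma min_le_D: "i \<le> n \<Longrightarrow> j \<le> n \<Longrightarrow> D i j \<noteq> 0 \<Longrightarrow> \<alpha> powr p \<le> D i j"
  using min_dist_le[of "x i" "x j"] min_dist_pos p_pos by (intro powr_mono2) auto

lemma null_class_D: "i \<le> n \<Longrightarrow> null_class {..n} D i = {i}"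
  using label_inj by (auto simp: null_class_def)

lemma null_class_D':
  assumes "i \<le> n"
  shows "null_class {..n} D' i = indices x n (M.mcball (x i) \<alpha>)"
proof -
  have "D' i j = 0 \<longleftrightarrow> d (x i) (x j) \<le> \<alpha>" for j
  proof -
    have "D' i j = 0 \<longleftrightarrow> D i j \<le> \<alpha> powr p" by auto
    also have "\<dots> \<longleftrightarrow> d (x i) (x j) \<le> \<alpha>"
      using p_pos min_dist_pos M.nonneg by (metis less_imp_le not_less powr_less_mono2 powr_mono2)
    finally show ?thesis .
  qed
  then show ?thesis using assms by (auto simp: null_class_def indices_def M.mcball_def)
qed

lemma D_apply:
  assumes "\<xi> \<in> Pi0 n" "i \<le> n"
  shows "(\<Sum>j\<le>n. D i j * \<xi> $ j) = (\<Sum>j\<le>n. D' i j * \<xi> $ j) - \<alpha> powr p * \<xi> $ i"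
  using kernel_apply_split[OF _ kernel_D, of i "\<alpha> powr p" "($) \<xi>"] assms min_le_D
  by (simp add: null_class_D Pi0_def)

lemma gramian_apply:
  assumes "\<xi> \<in> Pi0 n" "i < n"
  shows "(G *\<^sub>v drop_base n \<xi>) $ i =
    ((\<Sum>j\<le>n. D 0 j * \<xi> $ j) - (\<Sum>j\<le>n. D (Suc i) j * \<xi> $ j)) / 2"
  using assms M.commute by (intro gramian_mult_drop_base) auto

lemma F_space_eigenvector:
  assumes "\<xi> \<in> F_space X d x n"
  shows "G *\<^sub>v drop_base n \<xi> = (\<alpha> powr p / 2) \<cdot>\<^sub>v drop_base n \<xi>"
proof (rule eq_vecI)
  fix i assume "i < dim_vec ((\<alpha> powr p / 2) \<cdot>\<^sub>v drop_base n \<xi>)"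
  then have i: "i < n" by (simp add: drop_base_def)
  have \<xi>: "\<xi> \<in> Pi0 n" "\<xi> $ 0 = 0"
    and cls: "\<And>i. i \<le> n \<Longrightarrow> sum (($) \<xi>) (null_class {..n} D' i) = 0"
    using assms by (simp_all add: F_space_iff null_class_D')
  (* Each row of D' is constant on the classes, over which the coordinates sum to zero. *)
  have "(\<Sum>j\<le>n. D' i j * \<xi> $ j) = 0" if i: "i \<le> n" for i
  proof -
    have "(\<Sum>j\<le>n. D' i j * \<xi> $ j) = (\<Sum>j\<le>n. D' i j * sum (($) \<xi>) (null_class {..n} D' j)
        / card (null_class {..n} D' j))"
    proof (rule sum_eq_sum_class_sums[OF finite_atMost kernel_D'])
      fix j k assume "j \<in> {..n}" "k \<in> {..n}" "D' j k = 0"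
      then show "D' i j = D' i k" using i by (intro kernel_eq_of_zero[OF kernel_D']) simp_all
    qed
    also have "\<dots> = 0" using cls by (intro sum.neutral) simp
    finally show ?thesis .
  qed
  then have "(\<Sum>j\<le>n. D i j * \<xi> $ j) = - (\<alpha> powr p * \<xi> $ i)" if "i \<le> n" for i
    using D_apply[OF \<xi>(1)] that by simp
  then show "(G *\<^sub>v drop_base n \<xi>) $ i = ((\<alpha> powr p / 2) \<cdot>\<^sub>v drop_base n \<xi>) $ i"
    using i \<xi>(2) by (simp add: gramian_apply[OF \<xi>(1)]) (simp add: drop_base_def)
qed (simp add: gramian_def drop_base_def)

text \<open>The identity \<open>- (\<xi> \<bullet> D \<xi>) = \<alpha> powr p * (\<xi> \<bullet> \<xi>) - (\<xi> \<bullet> D' \<xi>)\<close>, evaluated at an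
  eigenvector and solved for the excess of its eigenvalue over \<open>\<alpha> powr p / 2\<close>. Both terms on
  the right are nonnegative, which bounds the eigenvalue from below and identifies the case
  of equality.\<close>

lemma eigen_identity:
  assumes \<xi>: "\<xi> \<in> Pi0 n" and eig: "G *\<^sub>v drop_base n \<xi> = k \<cdot>\<^sub>v drop_base n \<xi>"
  shows "(k - \<alpha> powr p / 2) * (\<Sum>i<n. (\<xi> $ Suc i)\<^sup>2) =
    \<alpha> powr p / 2 * (\<xi> $ 0)\<^sup>2 - quad_form {..n} D' (($) \<xi>) / 2"
proof -
  let ?a = "\<lambda>i. \<Sum>j\<le>n. D i j * \<xi> $ j"
  have \<xi>0: "(\<Sum>i\<le>n. \<xi> $ i) = 0" using \<xi> by (simp add: Pi0_def)
  (* Coordinate i of the Gramian vector belongs to the point x (Suc i). *)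
  have "?a 0 - ?a (Suc i) = 2 * k * \<xi> $ Suc i" if "i < n" for i
    using arg_cong[OF eig, of "\<lambda>v. v $ i"] that
    by (simp add: gramian_apply[OF \<xi>]) (simp add: drop_base_def)
  then have "2 * k * (\<Sum>i<n. (\<xi> $ Suc i)\<^sup>2) = (\<Sum>i<n. (?a 0 - ?a (Suc i)) * \<xi> $ Suc i)"
    by (simp add: sum_distrib_left power2_eq_square mult.assoc)
  (* The added term with index 0 vanishes. *)
  also have "\<dots> = (\<Sum>i\<le>n. (?a 0 - ?a i) * \<xi> $ i)"
    by (simp add: sum.atMost_shift)
  also have "\<dots> = ?a 0 * (\<Sum>i\<le>n. \<xi> $ i) - quad_form {..n} D (($) \<xi>)"
    by (simp add: quad_form_def left_diff_distrib sum_subtractf sum_distrib_left sum_distrib_right)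
  also have "\<dots> = - quad_form {..n} D (($) \<xi>)" using \<xi>0 by simp
  also have "quad_form {..n} D (($) \<xi>) =
      quad_form {..n} D' (($) \<xi>) - \<alpha> powr p * (\<Sum>i\<le>n. (\<xi> $ i)\<^sup>2)"
    using quad_form_split[OF _ kernel_D, of "\<alpha> powr p" "($) \<xi>"] min_le_D \<xi>0
    by (simp add: null_class_D power2_eq_square)
  also have "(\<Sum>i\<le>n. (\<xi> $ i)\<^sup>2) = (\<xi> $ 0)\<^sup>2 + (\<Sum>i<n. (\<xi> $ Suc i)\<^sup>2)"
    by (simp add: sum.atMost_shift)
  finally show ?thesis by (simp add: algebra_simps)
qed

lemma negative_type_D':
  assumes "\<xi> \<in> Pi0 n"
  shows "quad_form {..n} D' (($) \<xi>) \<le> 0"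
    and "quad_form {..n} D' (($) \<xi>) = 0 \<Longrightarrow> i \<le> n \<Longrightarrow>
      sum (($) \<xi>) (indices x n (M.mcball (x i) \<alpha>)) = 0"
  using ultrametric_kernel_negative_type[OF _ _ kernel_D', of "($) \<xi>"] assms null_class_D'
  by (auto simp: Pi0_def)

lemma min_le_eigenvalue:
  assumes "eigenvalue G k"
  shows "\<alpha> powr p / 2 \<le> k"
proof -
  obtain v where v: "v \<in> carrier_vec n" "v \<noteq> 0\<^sub>v n" "G *\<^sub>v v = k \<cdot>\<^sub>v v"
    using assms by (auto simp: eigenvalue_def eigenvector_def gramian_def)
  define \<xi> where "\<xi> = add_base n v"
  have \<xi>: "\<xi> \<in> Pi0 n" "drop_base n \<xi> = v"
    using v by (simp_all add: \<xi>_def add_base_Pi0 drop_add_base)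
  obtain i where "i < n" "v $ i \<noteq> 0"
    using v(1,2) by (metis carrier_vecD eq_vecI index_zero_vec(1,2))
  then have "\<xi> $ Suc i \<noteq> 0" using \<xi>(2) by (auto simp: drop_base_def)
  then have "0 < (\<Sum>i<n. (\<xi> $ Suc i)\<^sup>2)"
    using \<open>i < n\<close> by (intro sum_pos2[of _ i]) auto
  moreover have "0 \<le> (k - \<alpha> powr p / 2) * (\<Sum>i<n. (\<xi> $ Suc i)\<^sup>2)"
  proof -
    have "G *\<^sub>v drop_base n \<xi> = k \<cdot>\<^sub>v drop_base n \<xi>" using v(3) \<xi>(2) by simp
    note eigen_identity[OF \<xi>(1) this]
    moreover have "0 \<le> \<alpha> powr p / 2 * (\<xi> $ 0)\<^sup>2" by simp
    ultimately show ?thesis using negative_type_D'(1)[OF \<xi>(1)] by linarith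
  qed
  ultimately show ?thesis by (simp add: zero_le_mult_iff)
qed

lemma eigenspace_eq: "eigenspace G (\<alpha> powr p / 2) = drop_base n ` F_space X d x n"
proof
  show "drop_base n ` F_space X d x n \<subseteq> eigenspace G (\<alpha> powr p / 2)"
    using F_space_eigenvector by (auto simp: eigenspace_def gramian_def drop_base_def)
  show "eigenspace G (\<alpha> powr p / 2) \<subseteq> drop_base n ` F_space X d x n"
  proof
    fix v assume "v \<in> eigenspace G (\<alpha> powr p / 2)"
    then have v: "v \<in> carrier_vec n" "G *\<^sub>v v = (\<alpha> powr p / 2) \<cdot>\<^sub>v v"
      by (auto simp: eigenspace_def gramian_def)
    define \<xi> where "\<xi> = add_base n v"
    have \<xi>: "\<xi> \<in> Pi0 n" "drop_base n \<xi> = v"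
      using v by (simp_all add: \<xi>_def add_base_Pi0 drop_add_base)
    have "G *\<^sub>v drop_base n \<xi> = (\<alpha> powr p / 2) \<cdot>\<^sub>v drop_base n \<xi>"
      using v(2) \<xi>(2) by simp
    from eigen_identity[OF \<xi>(1) this]
    have id: "\<alpha> powr p / 2 * (\<xi> $ 0)\<^sup>2 = quad_form {..n} D' (($) \<xi>) / 2" by simp
    moreover have "0 \<le> \<alpha> powr p / 2 * (\<xi> $ 0)\<^sup>2" by simp
    ultimately have "quad_form {..n} D' (($) \<xi>) = 0"
      using negative_type_D'(1)[OF \<xi>(1)] by linarith
    moreover from this have "\<xi> $ 0 = 0" using id min_dist_pos by simp
    ultimately have "\<xi> \<in> F_space X d x n"
      using \<xi>(1) negative_type_D'(2)[OF \<xi>(1)] unfolding F_space_iff by blast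
    then show "v \<in> drop_base n ` F_space X d x n" using \<xi>(2) by blast
  qed
qed

lemma min_eigenvalue_eq:
  assumes "\<not> degenerate X d (x 0)"
  shows "min_eigenvalue G = \<alpha> powr p / 2"
  unfolding min_eigenvalue_def
proof (rule Min_eqI)
  have G: "G \<in> carrier_mat n n" by (simp add: gramian_def)
  have "char_poly G \<noteq> 0" using degree_monic_char_poly[OF G] by auto
  then have "finite {k. poly (char_poly G) k = 0}" by (rule poly_roots_finite)
  then show "finite {k. eigenvalue G k}" unfolding eigenvalue_root_char_poly[OF G] .
  obtain v where "v \<in> eigenspace G (\<alpha> powr p / 2)" "v \<noteq> 0\<^sub>v n"
    using drop_base_F_space_nonzero[OF assms] unfolding eigenspace_eq by blast
  then have "eigenvector G v (\<alpha> powr p / 2)"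
    using G by (simp add: eigenspace_def eigenvector_def)
  then show "\<alpha> powr p / 2 \<in> {k. eigenvalue G k}"
    unfolding eigenvalue_def by blast
qed (use min_le_eigenvalue in simp)

end

theorem theorem5p2:
  fixes X :: "'a set" and d :: "'a \<Rightarrow> 'a \<Rightarrow> real" and x :: "nat \<Rightarrow> 'a" and n :: nat and p :: real
  assumes "ultrametric_space X d"
    and "bij_betw x {0..n} X"
    and "card X = n + 1" and "n + 1 \<ge> 3"
    and "\<not> degenerate X d (x 0)"
    and "p > 0"
  shows "min_eigenvalue (gramian p d x n) = min_nonzero_dist X d powr p / 2 \<and>
    eigenspace (gramian p d x n) (min_eigenvalue (gramian p d x n)) = drop_base n ` F_space X d x n"
proof -
  interpret labelled_ultrametric_power X d x n p
    using assms by unfold_locales auto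
  show ?thesis unfolding min_eigenvalue_eq[OF assms(5)] using eigenspace_eq by blast
qed

end
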